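(* Let $n\ge 1$ and $m\ge 2$ be integers. Then $$H(nm+m-1)\ \ge\ m^2\,H(n).$$ Equivalently: given any planar polynomial vector field of degree $\le n$ having $k$ limit cycles, one can construct a planar polynomial vector field of degree $\le nm+m-1$ having at least $m^2k$ limit cycles.
   Context: A planar polynomial vector field is $X=(P,Q)$ with $P,Q\in\mathbb{R}[x,y]$, defining the system $\dot x=P(x,y)$, $\dot y=Q(x,y)$ on $\mathbb{R}^2$. Its degree is $\deg(X)=\max\{\deg P,\deg Q\}$ (total degree). A periodic orbit is a non-equilibrium closed trajectory of the flow. A limit cycle is a periodic orbit that is isolated among periodic orbits (equivalently, it corresponds to an isolated fixed point of a local Poincaré return map on a transverse section). $\pi(X)$ denotes the number of limit cycles of $X$ (possibly $+\infty$), and the Hilbert number is $$H(n)=\sup\{\pi(X): X \text{ a planar polynomial vector field with } \deg(X)\le n\}\in\{0,1,2,\dots\}\cup\{+\infty\}.$$ The inequality is understood in $\{0,1,2,\dots\}\cup\{+\infty\}$. *)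

theory Defs
  imports
    "HOL-Analysis.Analysis"
    "HOL-Computational_Algebra.Polynomial"
    "HOL-Library.Extended_Nat"
begin

text \<open>
  A polynomial in \<open>\<real>[x,y]\<close> is represented as an element of \<open>\<real>[x][y]\<close>: the coefficient of
  \<open>x^i y^j\<close> in \<open>p\<close> is \<open>coeff (coeff p j) i\<close>.
\<close>

type_synonym poly_xy = "real poly poly"

definition eval_xy :: "poly_xy \<Rightarrow> real \<Rightarrow> real \<Rightarrow> real" where
  "eval_xy p x y = poly (poly p [:y:]) x"

text \<open>The total degree of the zero polynomial is taken to be 0.\<close>

definition total_degree :: "poly_xy \<Rightarrow> nat" where
  "total_degree p = Max (insert 0 {i + j | i j. coeff (coeff p j) i \<noteq> 0})"

lemma eval_xy_altdef:
  "eval_xy p x y = (\<Sum>j\<le>degree p. \<Sum>i\<le>degree (coeff p j). coeff (coeff p j) i * x ^ i * y ^ j)"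
  by (simp add: eval_xy_def poly_altdef[of p] poly_sum poly_power poly_altdef[of "coeff p _"]
        sum_distrib_right)

lemma finite_monomials: "finite {i + j | i j. coeff (coeff (p :: poly_xy) j) i \<noteq> 0}"
proof (rule finite_subset)
  show "{i + j | i j. coeff (coeff p j) i \<noteq> 0}
    \<subseteq> (\<Union>j\<le>degree p. (\<lambda>i. i + j) ` {..degree (coeff p j)})"
  proof safe
    fix i j assume nz: "coeff (coeff p j) i \<noteq> 0"
    then have "j \<le> degree p" by (intro le_degree) auto
    moreover have "i \<le> degree (coeff p j)" using nz by (rule le_degree)
    ultimately show "i + j \<in> (\<Union>j\<le>degree p. (\<lambda>i. i + j) ` {..degree (coeff p j)})" by blast
  qed
qed auto

lemma total_degree_le_iff:
  "total_degree p \<le> n \<longleftrightarrow> (\<forall>i j. coeff (coeff p j) i \<noteq> 0 \<longrightarrow> i + j \<le> n)"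
  unfolding total_degree_def using finite_monomials[of p] by (subst Max_le_iff) auto

type_synonym poly_vf = "poly_xy \<times> poly_xy"

definition vf_eval :: "poly_vf \<Rightarrow> real \<times> real \<Rightarrow> real \<times> real" where
  "vf_eval X z = (eval_xy (fst X) (fst z) (snd z), eval_xy (snd X) (fst z) (snd z))"

definition vf_degree :: "poly_vf \<Rightarrow> nat" where
  "vf_degree X = max (total_degree (fst X)) (total_degree (snd X))"

definition vf_solution :: "poly_vf \<Rightarrow> (real \<Rightarrow> real \<times> real) \<Rightarrow> bool" where
  "vf_solution X \<gamma> \<longleftrightarrow> (\<forall>t. (\<gamma> has_vector_derivative vf_eval X (\<gamma> t)) (at t))"

text \<open>
  Orbits are subsets of the plane, so time translates of one solution count once.
\<close>

definition periodic_orbit :: "poly_vf \<Rightarrow> (real \<times> real) set \<Rightarrow> bool" where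
  "periodic_orbit X \<Gamma> \<longleftrightarrow>
     (\<exists>\<gamma> T. vf_solution X \<gamma> \<and> T > 0 \<and> (\<forall>t. \<gamma> (t + T) = \<gamma> t) \<and>
            (\<forall>t. vf_eval X (\<gamma> t) \<noteq> 0) \<and> \<Gamma> = range \<gamma>)"

definition limit_cycle :: "poly_vf \<Rightarrow> (real \<times> real) set \<Rightarrow> bool" where
  "limit_cycle X \<Gamma> \<longleftrightarrow> periodic_orbit X \<Gamma> \<and>
     (\<exists>U. open U \<and> \<Gamma> \<subseteq> U \<and> (\<forall>\<Gamma>'. periodic_orbit X \<Gamma>' \<and> \<Gamma>' \<subseteq> U \<longrightarrow> \<Gamma>' = \<Gamma>))"

definition num_limit_cycles :: "poly_vf \<Rightarrow> enat" where
  "num_limit_cycles X =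
     (if finite {\<Gamma>. limit_cycle X \<Gamma>} then enat (card {\<Gamma>. limit_cycle X \<Gamma>}) else \<infinity>)"

definition hilbert_number :: "nat \<Rightarrow> enat" where
  "hilbert_number n = (SUP X \<in> {X. vf_degree X \<le> n}. num_limit_cycles X)"

end

theory Submission
  imports Defs
begin

text \<open>
  Pull the vector field \<open>X = (P, Q)\<close> back along \<open>\<Phi>(x, y) = (p x, p y)\<close>, where \<open>p\<close> has degree \<open>m\<close>,
  and multiply by the Jacobian determinant \<open>p'(x) p'(y)\<close> to clear denominators: the result
  \<open>Y = (p'(y) P(p x, p y), p'(x) Q(p x, p y))\<close> has degree at most \<open>nm + m - 1\<close>. Taking for \<open>p\<close> a
  large multiple of a polynomial with \<open>m\<close> simple real roots, there are \<open>m\<close> disjoint open intervals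
  mapped diffeomorphically onto \<open>(-R, R)\<close>, hence \<open>m\<^sup>2\<close> disjoint boxes on each of which \<open>Y\<close> is, up to
  a nonvanishing time change, a copy of \<open>X\<close> restricted to \<open>(-R, R)\<^sup>2\<close>. Any finite set of limit
  cycles of \<open>X\<close> lies in such a square, and each of its members is lifted to every box.
\<close>

subsection \<open>Polynomial substitution and total degree\<close>

lemma total_degree_0: "total_degree 0 \<le> n"
  by (simp add: total_degree_le_iff)

lemma total_degree_add:
  assumes "total_degree p \<le> n" "total_degree q \<le> n"
  shows "total_degree (p + q) \<le> n"
  using assms unfolding total_degree_le_iff by (metis coeff_add add_0)

lemma total_degree_sum:
  assumes "\<And>i. i \<in> A \<Longrightarrow> total_degree (f i) \<le> n"
  shows "total_degree (sum f A) \<le> n"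
  using assms
  by (induction A rule: infinite_finite_induct) (auto intro: total_degree_add total_degree_0)

lemma total_degree_mult:
  assumes "total_degree p \<le> a" "total_degree q \<le> b"
  shows "total_degree (p * q) \<le> a + b"
  unfolding total_degree_le_iff
proof (intro allI impI)
  fix i j assume nz: "coeff (coeff (p * q) j) i \<noteq> 0"
  have "coeff (coeff (p * q) j) i =
      (\<Sum>k\<le>j. \<Sum>l\<le>i. coeff (coeff p k) l * coeff (coeff q (j - k)) (i - l))"
    by (simp add: coeff_mult coeff_sum)
  with nz obtain k where k: "k \<le> j"
      "(\<Sum>l\<le>i. coeff (coeff p k) l * coeff (coeff q (j - k)) (i - l)) \<noteq> 0"
    by (metis (no_types, lifting) atMost_iff sum.neutral)
  then obtain l where l: "l \<le> i" "coeff (coeff p k) l * coeff (coeff q (j - k)) (i - l) \<noteq> 0"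
    by (metis (no_types, lifting) atMost_iff sum.neutral)
  then have "l + k \<le> a" "(i - l) + (j - k) \<le> b"
    using assms unfolding total_degree_le_iff by (metis mult_zero_left mult_zero_right)+
  with k l show "i + j \<le> a + b" by linarith
qed

lemma total_degree_power:
  assumes "total_degree p \<le> a"
  shows "total_degree (p ^ k) \<le> k * a"
proof (induction k)
  case 0
  have "total_degree 1 \<le> 0"
    unfolding total_degree_le_iff by (auto simp: coeff_pCons one_pCons split: nat.splits)
  then show ?case by simp
next
  case (Suc k)
  then show ?case using total_degree_mult[OF assms Suc] by simp
qed

definition in_x :: "real poly \<Rightarrow> poly_xy" where
  "in_x p = [:p:]"

definition in_y :: "real poly \<Rightarrow> poly_xy" where
  "in_y p = map_poly (\<lambda>a. [:a:]) p"

lemma total_degree_in_x: "total_degree (in_x p) \<le> degree p"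
  by (auto simp: total_degree_le_iff in_x_def coeff_pCons le_degree split: nat.splits)

lemma total_degree_in_y: "total_degree (in_y p) \<le> degree p"
  by (auto simp: total_degree_le_iff in_y_def coeff_map_poly coeff_pCons le_degree
      split: nat.splits)

lemma eval_in_x [simp]: "eval_xy (in_x p) x y = poly p x"
  by (simp add: eval_xy_def in_x_def)

lemma eval_in_y [simp]: "eval_xy (in_y p) x y = poly p y"
proof -
  have "poly (poly (in_y p) [:y:]) x = poly p y"
    unfolding in_y_def by (induction p) (auto simp: map_poly_pCons)
  then show ?thesis by (simp add: eval_xy_def)
qed

lemma eval_xy_mult [simp]: "eval_xy (p * q) x y = eval_xy p x y * eval_xy q x y"
  by (simp add: eval_xy_def)

lemma eval_xy_power [simp]: "eval_xy (p ^ k) x y = eval_xy p x y ^ k"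
  by (simp add: eval_xy_def)

lemma eval_xy_sum [simp]: "eval_xy (sum f A) x y = (\<Sum>i\<in>A. eval_xy (f i) x y)"
  by (simp add: eval_xy_def poly_sum)

lemma exists_substitution:
  assumes "total_degree F \<le> n" "degree p \<le> m"
  obtains G where "total_degree G \<le> n * m"
    "\<And>x y. eval_xy G x y = eval_xy F (poly p x) (poly p y)"
proof
  let ?M = "\<lambda>j i. in_x [:coeff (coeff F j) i:] * in_x p ^ i * in_y p ^ j"
  let ?G = "\<Sum>j\<le>degree F. \<Sum>i\<le>degree (coeff F j). ?M j i"
  show "eval_xy ?G x y = eval_xy F (poly p x) (poly p y)" for x y
    by (simp add: eval_xy_altdef[of F])
  \<comment> \<open>A monomial of bidegree \<open>(i, j)\<close> becomes one of degree at most
    \<open>(i + j) * m\<close>. The bound \<open>i + j \<le> n\<close> is available only for nonzero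
    coefficients, hence the case split.\<close>
  have "total_degree (?M j i) \<le> n * m" for i j
  proof (cases "coeff (coeff F j) i = 0")
    case True
    then show ?thesis by (simp add: in_x_def total_degree_0)
  next
    case False
    then have "i + j \<le> n" using assms(1) by (auto simp: total_degree_le_iff)
    have "total_degree (?M j i) \<le> 0 + i * m + j * m"
      using total_degree_in_x[of "[:coeff (coeff F j) i:]"]
        total_degree_in_x[of p] total_degree_in_y[of p] assms(2)
      by (intro total_degree_mult total_degree_power) auto
    also have "\<dots> = (i + j) * m" by (simp add: algebra_simps)
    also have "\<dots> \<le> n * m" using \<open>i + j \<le> n\<close> by (rule mult_right_mono) simp
    finally show ?thesis .
  qed
  then show "total_degree ?G \<le> n * m" by (intro total_degree_sum)
qed

text \<open>The factors are crossed on purpose: differentiating \<open>poly p x\<close> along the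
  flow contributes p'(x), so putting p'(y) in the first component, and symmetrically p'(x) in the
  second, makes both components of the image velocity carry the same scalar p'(x) p'(y).\<close>

lemma exists_folded_vector_field:
  assumes "vf_degree X \<le> n" "degree p = m" "m \<ge> 1"
  obtains Y where "vf_degree Y \<le> n * m + m - 1"
    "\<forall>x y. vf_eval Y (x, y) =
      (poly (pderiv p) y * fst (vf_eval X (poly p x, poly p y)),
       poly (pderiv p) x * snd (vf_eval X (poly p x, poly p y)))"
proof -
  have "total_degree (fst X) \<le> n" "total_degree (snd X) \<le> n"
    using assms(1) by (auto simp: vf_degree_def)
  then obtain F G where F: "total_degree F \<le> n * m"
      "\<And>x y. eval_xy F x y = eval_xy (fst X) (poly p x) (poly p y)"
    and G: "total_degree G \<le> n * m"
      "\<And>x y. eval_xy G x y = eval_xy (snd X) (poly p x) (poly p y)"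
    using exists_substitution assms(2) by (metis order_refl)
  have q: "total_degree (in_x (pderiv p)) \<le> m - 1" "total_degree (in_y (pderiv p)) \<le> m - 1"
    using total_degree_in_x[of "pderiv p"] total_degree_in_y[of "pderiv p"] assms(2)
    by (auto simp: degree_pderiv)
  show ?thesis
  proof (rule that[of "(in_y (pderiv p) * F, in_x (pderiv p) * G)"])
    \<comment> \<open>The product bound is \<open>(m - 1) + n * m\<close>; with truncated
      subtraction, \<open>m \<ge> 1\<close> is what identifies it with
      \<open>n * m + m - 1\<close>.\<close>
    show "vf_degree (in_y (pderiv p) * F, in_x (pderiv p) * G) \<le> n * m + m - 1"
      using total_degree_mult[OF q(2) F(1)] total_degree_mult[OF q(1) G(1)] assms(3)
      by (simp add: vf_degree_def add.commute)
  qed (simp_all add: vf_eval_def F G)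
qed

subsection \<open>A polynomial with several full folds\<close>

text \<open>Near each simple root a polynomial maps an interval bijectively onto a neighbourhood of
  0. Finitely many roots admit a common neighbourhood \<open>(-E, E)\<close>, and multiplying the
  polynomial by \<open>R / E\<close> stretches it to \<open>(-R, R)\<close>.\<close>

lemma exists_folding_polynomial:
  fixes m :: nat and R :: real
  assumes "R > 0"
  obtains p :: "real poly" and I :: "nat \<Rightarrow> real set" where "degree p = m"
    "\<forall>i<m. open (I i)"
    "\<forall>i<m. bij_betw (poly p) (I i) {-R<..<R}"
    "\<forall>i<m. \<forall>x\<in>I i. poly (pderiv p) x \<noteq> 0"
    "\<forall>i<m. \<forall>j<m. i \<noteq> j \<longrightarrow> I i \<inter> I j = {}"
proof -
  define q :: "real poly" where "q = (\<Prod>i<m. [:- real i, 1:])"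
  have deg: "degree q = m" unfolding q_def by (subst degree_prod_eq_sum_degree) auto
  have root: "poly q (real i) = 0" if "i < m" for i
    using that by (auto simp: q_def poly_prod)
  have simple: "poly (pderiv q) (real i) \<noteq> 0" if "i < m" for i
  proof -
    have eq: "q = [:- real i, 1:] * (\<Prod>j\<in>{..<m} - {i}. [:- real j, 1:])"
      unfolding q_def using that by (subst prod.remove[of _ i]) auto
    have "poly (pderiv q) (real i) = poly (\<Prod>j\<in>{..<m} - {i}. [:- real j, 1:]) (real i)"
      by (subst eq, subst pderiv_mult) (simp add: pderiv_pCons)
    also have "\<dots> \<noteq> 0" by (auto simp: poly_prod)
    finally show ?thesis .
  qed
  \<comment> \<open>The roots are spaced by 1, so radii below 1/2 make the intervals disjoint.
    Halving \<open>e\<close> leaves a closed neighbourhood without critical points.\<close>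
  have "\<exists>d>0. d < 1/2 \<and> (\<forall>x. \<bar>x - real i\<bar> \<le> d \<longrightarrow> poly (pderiv q) x \<noteq> 0)" if "i < m" for i
  proof -
    have "isCont (poly (pderiv q)) (real i)" by simp
    then have "\<forall>\<^sub>F x in nhds (real i). poly (pderiv q) x \<noteq> 0"
      using simple[OF that] by (simp add: isCont_def tendsto_at_iff_tendsto_nhds tendsto_imp_eventually_ne)
    then obtain e where "e > 0" "\<And>x. dist x (real i) < e \<Longrightarrow> poly (pderiv q) x \<noteq> 0"
      unfolding eventually_nhds_metric by auto
    then show ?thesis
      by (intro exI[of _ "min (e/2) (1/4)"]) (auto simp: dist_real_def)
  qed
  then obtain d where d: "\<And>i. i < m \<Longrightarrow> d i > 0" "\<And>i. i < m \<Longrightarrow> d i < 1/2"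
    "\<And>i x. i < m \<Longrightarrow> \<bar>x - real i\<bar> \<le> d i \<Longrightarrow> poly (pderiv q) x \<noteq> 0"
    by metis
  have inj: "x = y" if i: "i < m" and x: "\<bar>x - real i\<bar> \<le> d i" and y: "\<bar>y - real i\<bar> \<le> d i"
    and "poly q x = poly q y" for i x y
  proof -
    \<comment> \<open>By Rolle, a repeated value would force a critical point strictly between
      \<open>u\<close> and \<open>v\<close>, still within distance \<open>d i\<close> of the
      root.\<close>
    have ne: False if "u < v" "poly q u = poly q v" "\<bar>u - real i\<bar> \<le> d i" "\<bar>v - real i\<bar> \<le> d i" for u v
    proof -
      obtain z where "u < z" "z < v" "DERIV (poly q) z :> 0"
        using Rolle[of u v "poly q"] \<open>u < v\<close> \<open>poly q u = poly q v\<close>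
        by (auto intro: continuous_on_poly[OF continuous_on_id])
      moreover have "poly (pderiv q) z \<noteq> 0"
        using d(3)[OF i, of z] that \<open>u < z\<close> \<open>z < v\<close> by (auto simp: abs_le_iff)
      ultimately show False using poly_DERIV DERIV_unique by blast
    qed
    show ?thesis using ne[of x y] ne[of y x] x y \<open>poly q x = poly q y\<close>
      by (cases x y rule: linorder_cases) auto
  qed
  have "\<exists>e>0. {-e<..<e} \<subseteq> poly q ` {real i - d i<..<real i + d i}" if i: "i < m" for i
  proof -
    have "open (poly q ` {real i - d i<..<real i + d i})"
      using inj[OF i]
      by (intro invariance_of_domain continuous_on_poly[OF continuous_on_id])
        (auto simp: inj_on_def abs_le_iff)
    moreover have "0 \<in> poly q ` {real i - d i<..<real i + d i}"
      using root[OF i] d(1)[OF i] by (intro image_eqI[of _ _ "real i"]) auto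
    ultimately obtain e where "e > 0" "ball 0 e \<subseteq> poly q ` {real i - d i<..<real i + d i}"
      using open_contains_ball by blast
    then show ?thesis by (auto simp: ball_eq_greaterThanLessThan intro!: exI[of _ e])
  qed
  then obtain e where e: "\<And>i. i < m \<Longrightarrow> e i > 0"
    "\<And>i. i < m \<Longrightarrow> {-e i<..<e i} \<subseteq> poly q ` {real i - d i<..<real i + d i}"
    by metis
  \<comment> \<open>Inserting 1 keeps the minimum well defined when \<open>m = 0\<close>.\<close>
  define E where "E = Min (insert 1 (e ` {..<m}))"
  have E: "E > 0" "\<And>i. i < m \<Longrightarrow> E \<le> e i"
    using e(1) unfolding E_def by (auto simp: Min_gr_iff)
  define p where "p = smult (R / E) q"
  \<comment> \<open>Cutting back to the preimage makes the image exactly \<open>(-R, R)\<close>, the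
    same for every root.\<close>
  define I where "I i = {real i - d i<..<real i + d i} \<inter> poly p -` {-R<..<R}" for i
  have RE: "R / E > 0" using assms E(1) by simp
  show ?thesis
  proof (rule that[of p I]; (intro allI impI ballI)?)
    show "degree p = m" using deg assms E(1) by (simp add: p_def)
  next
    fix i assume i: "i < m"
    show "open (I i)" unfolding I_def
      by (intro open_Int open_vimage continuous_intros open_greaterThanLessThan)
    show "poly (pderiv p) x \<noteq> 0" if "x \<in> I i" for x
      using d(3)[OF i, of x] that RE assms E(1)
      by (auto simp: p_def I_def pderiv_smult abs_le_iff)
    show "bij_betw (poly p) (I i) {-R<..<R}"
      unfolding bij_betw_def
    proof
      show "inj_on (poly p) (I i)"
        using inj[OF i] RE assms E(1) by (auto simp: inj_on_def I_def p_def abs_le_iff)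
      show "poly p ` I i = {-R<..<R}"
      proof safe
        fix v assume v: "v \<in> {-R<..<R}"
        then have "\<bar>v * E / R\<bar> < E"
          using E(1) assms by (simp add: abs_mult pos_divide_less_eq mult.commute abs_less_iff)
        then have "v * E / R \<in> {-e i<..<e i}"
          using E(2)[OF i] unfolding greaterThanLessThan_iff abs_less_iff by linarith
        then obtain x where "x \<in> {real i - d i<..<real i + d i}" "poly q x = v * E / R"
          using e(2)[OF i] by fastforce
        then show "v \<in> poly p ` I i" using v E(1) assms
          by (intro image_eqI[of _ _ x]) (auto simp: I_def p_def)
      qed (auto simp: I_def)
    qed
    fix j assume j: "j < m" "i \<noteq> j"
    show "I i \<inter> I j = {}"
    proof (rule ccontr)
      assume "I i \<inter> I j \<noteq> {}"
      then obtain x where "x \<in> I i" "x \<in> I j" by blast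
      then have "\<bar>x - real i\<bar> < d i" "\<bar>x - real j\<bar> < d j"
        by (auto simp: I_def abs_less_iff)
      then have "\<bar>real i - real j\<bar> < 1"
        using d(2)[OF i] d(2)[OF j(1)] by linarith
      then show False using j(2) by linarith
    qed
  qed
qed

subsection \<open>Time changes of periodic orbits\<close>

text \<open>Serves twice: to invert the new time parameter, and to differentiate the local inverses
  of the folding polynomial.\<close>

lemma has_real_derivative_inverse_strong:
  fixes f g :: "real \<Rightarrow> real"
  assumes "open S" "x \<in> S" "continuous_on S f" "\<And>x. x \<in> S \<Longrightarrow> g (f x) = x"
    and "(f has_real_derivative d) (at x)" "d \<noteq> 0"
  shows "(g has_real_derivative inverse d) (at (f x))"
  using has_derivative_inverse_strong[of S x f g "(*) d" "(*) (inverse d)"] assms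
  by (simp add: has_field_derivative_def fun_eq_iff)

text \<open>
  The new time is an antiderivative of \<open>h\<close>. Since \<open>h\<close> may be negative, the orbit may be run through
  backwards, which is why the new period below is an absolute value.
\<close>

lemma periodic_orbit_time_change:
  fixes \<gamma> :: "real \<Rightarrow> real \<times> real" and h :: "real \<Rightarrow> real"
  assumes "T > 0" and per: "\<And>t. \<gamma> (t + T) = \<gamma> t"
    and der: "\<And>t. (\<gamma> has_vector_derivative h t *\<^sub>R vf_eval X (\<gamma> t)) (at t)"
    and cont: "\<And>t. isCont h t" and hper: "\<And>t. h (t + T) = h t" and h0: "\<And>t. h t \<noteq> 0"
    and nz: "\<And>t. vf_eval X (\<gamma> t) \<noteq> 0"
  shows "periodic_orbit X (range \<gamma>)"
proof -
  obtain g where g: "\<And>t. (g has_real_derivative h t) (at t)"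
    using einterval_antiderivative[of "-\<infinity>" "\<infinity>" h] cont
    by (auto simp: has_real_derivative_iff_has_vector_derivative)
  have gcont: "isCont g t" for t using g DERIV_isCont by blast
  have ne: False if "a < b" "g a = g b" for a b
  proof -
    have diff: "g differentiable (at x)" for x using g real_differentiable_def by blast
    have "continuous_on {a..b} g" by (simp add: gcont continuous_at_imp_continuous_on)
    from Rolle[OF that this diff] obtain z where "DERIV g z :> 0" by auto
    with g[of z] have "h z = 0" by (rule DERIV_unique)
    then show False using h0 by simp
  qed
  have inj: "inj g"
  proof (rule injI)
    show "x = y" if "g x = g y" for x y
      using ne[of x y] ne[of y x] that by (cases x y rule: linorder_cases) auto
  qed
  \<comment> \<open>The signed length of one period in the new time. It is nonzero because
    \<open>g\<close> is injective.\<close>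
  define S where "S = g T - g 0"
  have shift: "g (t + T) = g t + S" for t
  proof -
    have "((\<lambda>t. g (t + T) - g t) has_real_derivative 0) (at t)" for t
      using DERIV_diff[OF DERIV_shift[THEN iffD1, OF g[of "t + T"]] g[of t]] hper by simp
    from DERIV_isconst_all[OF allI, OF this, of t 0]
    have "g (t + T) - g t = g (0 + T) - g 0" .
    then show ?thesis by (simp add: S_def)
  qed
  have "S \<noteq> 0" using ne[of 0 T] \<open>T > 0\<close> by (auto simp: S_def)
  have shift_nat: "g (t + real n * T) = g t + real n * S" for n t
  proof (induction n)
    case (Suc n)
    then show ?case using shift[of "t + real n * T"] by (simp add: algebra_simps)
  qed simp
  \<comment> \<open>Each period shifts \<open>g\<close> by \<open>S\<close>, so its values at
    multiples of \<open>T\<close> are unbounded in both directions. The intermediate value theorem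
    fills the gaps; the sign of \<open>S\<close> decides which end is the lower one.\<close>
  have "s \<in> range g" for s
  proof -
    obtain n where n: "\<bar>s - g 0\<bar> < real n * \<bar>S\<bar>"
      using reals_Archimedean3[of "\<bar>S\<bar>"] \<open>S \<noteq> 0\<close> by auto
    have le: "- (real n * T) \<le> real n * T" using \<open>T > 0\<close> by (simp add: mult_nonneg_nonneg)
    have "g (real n * T) = g 0 + real n * S" "g (- (real n * T)) = g 0 - real n * S"
      using shift_nat[of 0 n] shift_nat[of "- (real n * T)" n] by auto
    then consider "g (- (real n * T)) \<le> s \<and> s \<le> g (real n * T)"
      | "g (real n * T) \<le> s \<and> s \<le> g (- (real n * T))"
      using n by (cases "S > 0") (auto simp: abs_if split: if_splits)
    then show ?thesis
      using IVT[of g "- (real n * T)" s "real n * T"] IVT2[of g "real n * T" s "- (real n * T)"]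
        gcont le by cases auto
  qed
  then have "bij g" using inj by (auto simp: bij_def)
  define \<sigma> where "\<sigma> = inv g"
  have \<sigma>g: "\<sigma> (g t) = t" and g\<sigma>: "g (\<sigma> t) = t" for t
    using \<open>bij g\<close> by (auto simp: \<sigma>_def bij_is_inj bij_is_surj surj_f_inv_f)
  \<comment> \<open>The derivative 1/h of the inverse time cancels the factor \<open>h\<close> in
    the velocity of \<open>\<gamma>\<close>.\<close>
  have \<sigma>der: "(\<sigma> has_real_derivative inverse (h (\<sigma> s))) (at s)" for s
    using has_real_derivative_inverse_strong[OF open_UNIV UNIV_I _ _ g[of "\<sigma> s"] h0, of \<sigma>] gcont \<sigma>g g\<sigma>
    by (auto simp: continuous_at_imp_continuous_on)
  have "\<sigma> (s + S) = \<sigma> s + T" for s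
    using \<sigma>g shift[of "\<sigma> s"] g\<sigma> by metis
  then have per_S: "\<gamma> (\<sigma> (s + S)) = \<gamma> (\<sigma> s)" for s using per by simp
  have "\<gamma> (\<sigma> (s + \<bar>S\<bar>)) = \<gamma> (\<sigma> s)" for s
    using per_S[of s] per_S[of "s - S"] by (auto simp: abs_if)
  moreover have "((\<gamma> \<circ> \<sigma>) has_vector_derivative vf_eval X ((\<gamma> \<circ> \<sigma>) s)) (at s)" for s
    using vector_diff_chain_at[OF \<sigma>der[of s, unfolded has_real_derivative_iff_has_vector_derivative] der]
      h0 by simp
  moreover have "range (\<gamma> \<circ> \<sigma>) = range \<gamma>"
    using \<sigma>g by (metis image_comp surjI)
  ultimately show ?thesis
    unfolding periodic_orbit_def vf_solution_def using nz \<open>S \<noteq> 0\<close>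
    by (intro exI[of _ "\<gamma> \<circ> \<sigma>"] exI[of _ "\<bar>S\<bar>"]) auto
qed


subsection \<open>Lifting limit cycles to a box\<close>

text \<open>One box of the grid, with \<open>S\<close> standing for \<open>(-R, R)\<close>.
  \<open>I\<close> and \<open>J\<close> may coincide, which covers the diagonal boxes.\<close>

locale folded_box =
  fixes X Y :: poly_vf and p :: "real poly" and I J S :: "real set"
  assumes open_I: "open I" and open_J: "open J"
    and bij_I: "bij_betw (poly p) I S" and bij_J: "bij_betw (poly p) J S"
    and nz_I: "\<And>x. x \<in> I \<Longrightarrow> poly (pderiv p) x \<noteq> 0"
    and nz_J: "\<And>x. x \<in> J \<Longrightarrow> poly (pderiv p) x \<noteq> 0"
    and eval_Y: "\<And>x y. vf_eval Y (x, y) =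
      (poly (pderiv p) y * fst (vf_eval X (poly p x, poly p y)),
       poly (pderiv p) x * snd (vf_eval X (poly p x, poly p y)))"
begin

definition \<Phi> :: "real \<times> real \<Rightarrow> real \<times> real" where
  "\<Phi> z = (poly p (fst z), poly p (snd z))"

definition jac :: "real \<times> real \<Rightarrow> real" where
  "jac z = poly (pderiv p) (fst z) * poly (pderiv p) (snd z)"

text \<open>Only the part of the preimage inside this box is kept, so that \<open>lift\<close> and
  the image under \<open>\<Phi>\<close> are mutually inverse between subsets of
  \<open>S \<times> S\<close> and subsets of the box.\<close>

definition lift :: "(real \<times> real) set \<Rightarrow> (real \<times> real) set" where
  "lift \<Gamma> = (I \<times> J) \<inter> \<Phi> -` \<Gamma>"

lemma inj_\<Phi>: "inj_on \<Phi> (I \<times> J)"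
  using bij_I bij_J by (auto simp: inj_on_def \<Phi>_def bij_betw_def)

lemma image_\<Phi>: "\<Phi> ` (I \<times> J) = S \<times> S"
proof -
  have "\<Phi> ` (I \<times> J) = poly p ` I \<times> poly p ` J"
    by (auto simp: \<Phi>_def image_iff)
  then show ?thesis using bij_I bij_J by (simp add: bij_betw_def)
qed

lemma image_lift: "\<Gamma> \<subseteq> S \<times> S \<Longrightarrow> \<Phi> ` lift \<Gamma> = \<Gamma>"
proof -
  assume "\<Gamma> \<subseteq> S \<times> S"
  then have "\<Gamma> \<subseteq> \<Phi> ` (I \<times> J)" by (simp add: image_\<Phi>)
  then show ?thesis unfolding lift_def by blast
qed

lemma lift_image: "\<Gamma> \<subseteq> I \<times> J \<Longrightarrow> lift (\<Phi> ` \<Gamma>) = \<Gamma>"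
proof -
  assume \<Gamma>: "\<Gamma> \<subseteq> I \<times> J"
  have "z \<in> \<Gamma> \<longleftrightarrow> \<Phi> z \<in> \<Phi> ` \<Gamma>" if "z \<in> I \<times> J" for z
    using inj_on_image_mem_iff[OF inj_\<Phi> that \<Gamma>] by simp
  then show ?thesis unfolding lift_def using \<Gamma> by blast
qed

lemma open_lift:
  assumes "open U"
  shows "open (lift U)"
proof -
  have "continuous_on UNIV \<Phi>"
    unfolding \<Phi>_def by (intro continuous_intros)
  then show ?thesis
    unfolding lift_def by (intro open_Int open_Times open_I open_J open_vimage assms)
qed

lemma isCont_jac: "isCont jac z"
  unfolding jac_def by (intro continuous_intros)

lemma jac_nonzero: "z \<in> I \<times> J \<Longrightarrow> jac z \<noteq> 0"
  using nz_I nz_J by (auto simp: jac_def)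

lemma vf_eval_nonzero_iff:
  "z \<in> I \<times> J \<Longrightarrow> vf_eval Y z \<noteq> 0 \<longleftrightarrow> vf_eval X (\<Phi> z) \<noteq> 0"
  using nz_I[of "fst z"] nz_J[of "snd z"] eval_Y[of "fst z" "snd z"]
  by (auto simp: \<Phi>_def prod_eq_iff)

text \<open>By the chain rule the image curve has velocity \<open>jac\<close> times
  \<open>X\<close>, and \<open>jac\<close> does not vanish on the box, so the image is a periodic
  orbit after a time change.\<close>

lemma periodic_orbit_image:
  assumes "periodic_orbit Y \<Gamma>" "\<Gamma> \<subseteq> I \<times> J"
  shows "periodic_orbit X (\<Phi> ` \<Gamma>)"
proof -
  obtain \<gamma> T where sol: "vf_solution Y \<gamma>" and T: "T > 0" "\<forall>t. \<gamma> (t + T) = \<gamma> t"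
    and nz: "\<forall>t. vf_eval Y (\<gamma> t) \<noteq> 0" and \<Gamma>: "\<Gamma> = range \<gamma>"
    using assms(1) unfolding periodic_orbit_def by blast
  have der: "(\<gamma> has_vector_derivative vf_eval Y (\<gamma> t)) (at t)" for t
    using sol by (simp add: vf_solution_def)
  have in_box: "\<gamma> t \<in> I \<times> J" for t using assms(2) \<Gamma> by auto
  have "periodic_orbit X (range (\<lambda>t. \<Phi> (\<gamma> t)))"
  proof (rule periodic_orbit_time_change[where T = T and h = "\<lambda>t. jac (\<gamma> t)"])
    fix t
    have "((\<lambda>t. fst (\<gamma> t)) has_vector_derivative fst (vf_eval Y (\<gamma> t))) (at t)"
      "((\<lambda>t. snd (\<gamma> t)) has_vector_derivative snd (vf_eval Y (\<gamma> t))) (at t)"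
      using bounded_linear.has_vector_derivative[OF bounded_linear_fst der]
        bounded_linear.has_vector_derivative[OF bounded_linear_snd der] by auto
    then have "((\<lambda>t. poly p (fst (\<gamma> t))) has_vector_derivative
        poly (pderiv p) (fst (\<gamma> t)) * fst (vf_eval Y (\<gamma> t))) (at t)"
      "((\<lambda>t. poly p (snd (\<gamma> t))) has_vector_derivative
        poly (pderiv p) (snd (\<gamma> t)) * snd (vf_eval Y (\<gamma> t))) (at t)"
      using DERIV_chain2[OF poly_DERIV]
      by (auto simp: has_real_derivative_iff_has_vector_derivative[symmetric])
    from has_vector_derivative_Pair[OF this]
    show "((\<lambda>t. \<Phi> (\<gamma> t)) has_vector_derivative jac (\<gamma> t) *\<^sub>R vf_eval X (\<Phi> (\<gamma> t))) (at t)"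
      by (cases "\<gamma> t") (simp add: \<Phi>_def jac_def eval_Y scaleR_prod_def mult_ac)
    have "isCont \<gamma> t" using der has_vector_derivative_continuous by blast
    then show "isCont (\<lambda>t. jac (\<gamma> t)) t" using isCont_jac continuous_within_compose3 by blast
    show "vf_eval X (\<Phi> (\<gamma> t)) \<noteq> 0" using vf_eval_nonzero_iff in_box nz by blast
  qed (use T jac_nonzero in_box in auto)
  then show ?thesis by (simp add: \<Gamma> image_image)
qed

text \<open>The solution is carried into the box by the inverse branches \<open>a\<close> and
  \<open>b\<close> of the polynomial; the resulting curve follows \<open>Y\<close> with time factor
  1/\<open>jac\<close>.\<close>

lemma periodic_orbit_lift:
  assumes "periodic_orbit X \<Gamma>" "\<Gamma> \<subseteq> S \<times> S"
  shows "periodic_orbit Y (lift \<Gamma>)"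
proof -
  obtain \<gamma> T where sol: "vf_solution X \<gamma>" and T: "T > 0" "\<forall>t. \<gamma> (t + T) = \<gamma> t"
    and nz: "\<forall>t. vf_eval X (\<gamma> t) \<noteq> 0" and \<Gamma>: "\<Gamma> = range \<gamma>"
    using assms(1) unfolding periodic_orbit_def by blast
  have der: "(\<gamma> has_vector_derivative vf_eval X (\<gamma> t)) (at t)" for t
    using sol by (simp add: vf_solution_def)
  define a where "a = inv_into I (poly p)"
  define b where "b = inv_into J (poly p)"
  have a: "v \<in> S \<Longrightarrow> a v \<in> I" "v \<in> S \<Longrightarrow> poly p (a v) = v" "x \<in> I \<Longrightarrow> a (poly p x) = x" for v x
    using bij_I unfolding a_def
    by (auto simp: bij_betw_def inv_into_into f_inv_into_f)
  have b: "v \<in> S \<Longrightarrow> b v \<in> J" "v \<in> S \<Longrightarrow> poly p (b v) = v" "x \<in> J \<Longrightarrow> b (poly p x) = x" for v x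
    using bij_J unfolding b_def
    by (auto simp: bij_betw_def inv_into_into f_inv_into_f)
  have a': "(a has_real_derivative inverse (poly (pderiv p) (a v))) (at v)" if "v \<in> S" for v
    using has_real_derivative_inverse_strong[OF open_I a(1)[OF that] _ a(3) poly_DERIV nz_I] that a
    by (auto intro: continuous_on_poly[OF continuous_on_id])
  have b': "(b has_real_derivative inverse (poly (pderiv p) (b v))) (at v)" if "v \<in> S" for v
    using has_real_derivative_inverse_strong[OF open_J b(1)[OF that] _ b(3) poly_DERIV nz_J] that b
    by (auto intro: continuous_on_poly[OF continuous_on_id])
  define \<delta> where "\<delta> t = (a (fst (\<gamma> t)), b (snd (\<gamma> t)))" for t
  have in_S: "fst (\<gamma> t) \<in> S" "snd (\<gamma> t) \<in> S" for t
    using assms(2) \<Gamma> by (metis mem_Times_iff rangeI subsetD)+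
  have in_box: "\<delta> t \<in> I \<times> J" and \<Phi>\<delta>: "\<Phi> (\<delta> t) = \<gamma> t" for t
    using a b in_S by (auto simp: \<delta>_def \<Phi>_def)
  have "periodic_orbit Y (range \<delta>)"
  proof (rule periodic_orbit_time_change[where T = T and h = "\<lambda>t. inverse (jac (\<delta> t))"])
    fix t
    have "((\<lambda>t. fst (\<gamma> t)) has_vector_derivative fst (vf_eval X (\<gamma> t))) (at t)"
      "((\<lambda>t. snd (\<gamma> t)) has_vector_derivative snd (vf_eval X (\<gamma> t))) (at t)"
      using bounded_linear.has_vector_derivative[OF bounded_linear_fst der]
        bounded_linear.has_vector_derivative[OF bounded_linear_snd der] by auto
    then have "((\<lambda>t. a (fst (\<gamma> t))) has_vector_derivative
        inverse (poly (pderiv p) (a (fst (\<gamma> t)))) * fst (vf_eval X (\<gamma> t))) (at t)"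
      "((\<lambda>t. b (snd (\<gamma> t))) has_vector_derivative
        inverse (poly (pderiv p) (b (snd (\<gamma> t)))) * snd (vf_eval X (\<gamma> t))) (at t)"
      using DERIV_chain2[where g = "\<lambda>t. fst (\<gamma> t)" and x = t, OF a'[OF in_S(1)]]
        DERIV_chain2[where g = "\<lambda>t. snd (\<gamma> t)" and x = t, OF b'[OF in_S(2)]]
      by (auto simp: has_real_derivative_iff_has_vector_derivative[symmetric])
    from has_vector_derivative_Pair[OF this]
    \<comment> \<open>Writing P / p'(x) as p'(y) P / (p'(x) p'(y)) exhibits the first component of
      \<open>Y\<close> divided by \<open>jac\<close>; the second is symmetric.\<close>
    show d: "(\<delta> has_vector_derivative inverse (jac (\<delta> t)) *\<^sub>R vf_eval Y (\<delta> t)) (at t)"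
      using in_S[of t] a(1,2) b(1,2) nz_I[of "a (fst (\<gamma> t))"] nz_J[of "b (snd (\<gamma> t))"]
      by (simp add: \<delta>_def[abs_def] jac_def eval_Y scaleR_prod_def field_simps)
    then have "isCont \<delta> t" using has_vector_derivative_continuous by blast
    then have "isCont (\<lambda>t. jac (\<delta> t)) t" using isCont_jac continuous_within_compose3 by blast
    then show "isCont (\<lambda>t. inverse (jac (\<delta> t))) t"
      using jac_nonzero in_box by (intro continuous_intros) auto
    show "vf_eval Y (\<delta> t) \<noteq> 0" using vf_eval_nonzero_iff[OF in_box] nz \<Phi>\<delta> by simp
  qed (use T jac_nonzero in_box in \<open>auto simp: \<delta>_def\<close>)
  moreover have "range \<delta> = lift \<Gamma>"
  proof -
    have "lift \<Gamma> = lift (\<Phi> ` range \<delta>)" by (simp add: \<Gamma> image_image \<Phi>\<delta>)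
    then show ?thesis using lift_image[of "range \<delta>"] in_box by auto
  qed
  ultimately show ?thesis by simp
qed

text \<open>Isolation transfers because \<open>lift U\<close> is an open set inside the box: a
  periodic orbit of \<open>Y\<close> contained in it projects to one of \<open>X\<close> in
  \<open>U\<close>, and \<open>\<Phi>\<close> is injective on the box.\<close>

lemma limit_cycle_lift:
  assumes "limit_cycle X \<Gamma>" "\<Gamma> \<subseteq> S \<times> S"
  shows "limit_cycle Y (lift \<Gamma>)"
proof -
  obtain U where U: "open U" "\<Gamma> \<subseteq> U" "\<And>\<Gamma>'. periodic_orbit X \<Gamma>' \<Longrightarrow> \<Gamma>' \<subseteq> U \<Longrightarrow> \<Gamma>' = \<Gamma>"
    using assms(1) unfolding limit_cycle_def by blast
  have "\<Gamma>' = lift \<Gamma>" if "periodic_orbit Y \<Gamma>'" "\<Gamma>' \<subseteq> lift U" for \<Gamma>'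
  proof -
    have box: "\<Gamma>' \<subseteq> I \<times> J" and "\<Phi> ` \<Gamma>' \<subseteq> U" using that(2) by (auto simp: lift_def)
    then have "\<Phi> ` \<Gamma>' = \<Gamma>" using U(3) periodic_orbit_image that(1) by blast
    then show ?thesis using lift_image box by metis
  qed
  moreover have "lift \<Gamma> \<subseteq> lift U" using U(2) by (auto simp: lift_def)
  moreover have "periodic_orbit Y (lift \<Gamma>)"
    using periodic_orbit_lift assms by (simp add: limit_cycle_def)
  ultimately show ?thesis
    unfolding limit_cycle_def using open_lift[OF U(1)] by blast
qed

end

subsection \<open>Counting\<close>

text \<open>The orbit is the continuous image of a single compact period. This is what allows a
  square to be placed around finitely many limit cycles.\<close>

lemma bounded_periodic_orbit:
  assumes "periodic_orbit X \<Gamma>"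
  shows "bounded \<Gamma>"
proof -
  obtain \<gamma> T where sol: "vf_solution X \<gamma>" and T: "T > 0" "\<forall>t. \<gamma> (t + T) = \<gamma> t"
    and \<Gamma>: "\<Gamma> = range \<gamma>"
    using assms unfolding periodic_orbit_def by blast
  have "(\<gamma> has_vector_derivative vf_eval X (\<gamma> t)) (at t)" for t
    using sol by (simp add: vf_solution_def)
  then have "isCont \<gamma> t" for t by (rule has_vector_derivative_continuous)
  have nat: "\<gamma> (t + real n * T) = \<gamma> t" for t n
  proof (induction n)
    case (Suc n)
    then show ?case using T(2)[rule_format, of "t + real n * T"] by (simp add: algebra_simps)
  qed simp
  have int: "\<gamma> (t + of_int k * T) = \<gamma> t" for t k
    using nat[of t "nat k"] nat[of "t + of_int k * T" "nat (- k)"]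
    by (cases "k \<ge> 0") auto
  have "\<gamma> t \<in> \<gamma> ` {0..T}" for t
  proof (rule image_eqI)
    \<comment> \<open>Subtracting \<open>k\<close> whole periods brings \<open>t\<close> into
      \<open>{0..T}\<close>.\<close>
    define k where "k = \<lfloor>t / T\<rfloor>"
    show "\<gamma> t = \<gamma> (t + of_int (- k) * T)" using int[of t "- k"] by simp
    have "of_int k \<le> t / T" "t / T < of_int k + 1" unfolding k_def by linarith+
    then show "t + of_int (- k) * T \<in> {0..T}"
      using T(1) by (auto simp: field_simps)
  qed
  then have "\<Gamma> \<subseteq> \<gamma> ` {0..T}" using \<Gamma> by auto
  moreover have "compact (\<gamma> ` {0..T})"
    by (simp add: \<open>\<And>t. isCont \<gamma> t\<close> compact_continuous_image continuous_at_imp_continuous_on)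
  ultimately show ?thesis using bounded_subset compact_imp_bounded by blast
qed

lemma enat_card_le_hilbert_number:
  assumes "vf_degree X \<le> n" "finite A" "\<And>\<Gamma>. \<Gamma> \<in> A \<Longrightarrow> limit_cycle X \<Gamma>"
  shows "enat (card A) \<le> hilbert_number n"
proof -
  have "enat (card A) \<le> num_limit_cycles X"
    using assms(2,3) by (auto simp: num_limit_cycles_def intro!: card_mono)
  also have "\<dots> \<le> hilbert_number n"
    unfolding hilbert_number_def using assms(1) by (intro SUP_upper) simp
  finally show ?thesis .
qed

text \<open>Stated for a finite set \<open>A\<close>, since one \<open>R\<close>, and hence one
  polynomial \<open>p\<close>, has to serve all its members; infinitely many limit cycles could have
  an unbounded union.\<close>

lemma card_limit_cycles_folding:
  assumes X: "vf_degree X \<le> n" and m: "m \<ge> 1"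
    and A: "finite A" "\<And>\<Gamma>. \<Gamma> \<in> A \<Longrightarrow> limit_cycle X \<Gamma>"
  shows "enat (m ^ 2 * card A) \<le> hilbert_number (n * m + m - 1)"
proof -
  have "bounded (\<Union>A)"
    using A(1) bounded_periodic_orbit A(2) unfolding limit_cycle_def
    by (intro bounded_Union) blast+
  then obtain R where R: "R > 0" "\<And>z. z \<in> \<Union>A \<Longrightarrow> norm z < R"
    by (meson bounded_pos_less)
  have square: "\<Gamma> \<subseteq> {-R<..<R} \<times> {-R<..<R}" if "\<Gamma> \<in> A" for \<Gamma>
  proof
    fix z assume "z \<in> \<Gamma>"
    then have "norm z < R" using R(2) that by blast
    then have "\<bar>fst z\<bar> < R" "\<bar>snd z\<bar> < R"
      using norm_fst_le[of "fst z" "snd z"] norm_snd_le[of "snd z" "fst z"] by auto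
    then show "z \<in> {-R<..<R} \<times> {-R<..<R}" by (auto simp: mem_Times_iff abs_less_iff)
  qed
  obtain p I where p: "degree p = m" "\<forall>i<m. open (I i)"
    "\<forall>i<m. bij_betw (poly p) (I i) {-R<..<R}"
    "\<forall>i<m. \<forall>x\<in>I i. poly (pderiv p) x \<noteq> 0"
    "\<forall>i<m. \<forall>j<m. i \<noteq> j \<longrightarrow> I i \<inter> I j = {}"
    using R(1) by (rule exists_folding_polynomial)
  obtain Y where Y: "vf_degree Y \<le> n * m + m - 1"
    "\<forall>x y. vf_eval Y (x, y) =
      (poly (pderiv p) y * fst (vf_eval X (poly p x, poly p y)),
       poly (pderiv p) x * snd (vf_eval X (poly p x, poly p y)))"
    using X p(1) m by (rule exists_folded_vector_field)
  have box: "folded_box X Y p (I i) (I j) {-R<..<R}" if "i < m" "j < m" for i j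
    by unfold_locales (use p Y that in auto)
  define L where "L = (\<lambda>(i, j, \<Gamma>). folded_box.lift p (I i) (I j) \<Gamma>)"
  define D where "D = {..<m} \<times> {..<m} \<times> A"
  have "inj_on L D"
  proof (rule inj_onI)
    fix s s' assume s: "s \<in> D" "s' \<in> D" and eq: "L s = L s'"
    obtain i j \<Gamma> i' j' \<Gamma>' where ss: "s = (i, j, \<Gamma>)" "s' = (i', j', \<Gamma>')" by (metis prod_cases3)
    have lt: "i < m" "j < m" "i' < m" "j' < m" and \<Gamma>: "\<Gamma> \<in> A" "\<Gamma>' \<in> A"
      using s ss by (auto simp: D_def)
    interpret a: folded_box X Y p "I i" "I j" "{-R<..<R}" by (rule box[OF lt(1,2)])
    interpret b: folded_box X Y p "I i'" "I j'" "{-R<..<R}" by (rule box[OF lt(3,4)])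
    have eq': "a.lift \<Gamma> = b.lift \<Gamma>'" using eq by (simp add: L_def ss)
    \<comment> \<open>Nonempty lifts are needed to tell boxes apart: a common point of two lifts
      forces the same intervals by disjointness. Within one box, \<open>\<Phi>\<close> recovers the
      original cycle.\<close>
    have "\<Gamma> \<noteq> {}" using A(2)[OF \<Gamma>(1)] by (auto simp: limit_cycle_def periodic_orbit_def)
    then have "a.lift \<Gamma> \<noteq> {}" using a.image_lift[OF square[OF \<Gamma>(1)]] by auto
    then obtain z where "z \<in> a.lift \<Gamma>" "z \<in> b.lift \<Gamma>'" using eq' by auto
    then have "fst z \<in> I i \<inter> I i'" "snd z \<in> I j \<inter> I j'"
      by (auto simp: a.lift_def b.lift_def)
    then have ij: "i = i'" "j = j'" using p(5) lt by blast+
    have "\<Gamma> = \<Gamma>'"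
      using a.image_lift[OF square[OF \<Gamma>(1)]] b.image_lift[OF square[OF \<Gamma>(2)]] eq' by simp
    then show "s = s'" using ij ss by simp
  qed
  then have "card (L ` D) = m ^ 2 * card A"
    by (simp add: card_image D_def card_cartesian_product power2_eq_square)
  moreover have "limit_cycle Y \<Lambda>" if \<Lambda>: "\<Lambda> \<in> L ` D" for \<Lambda>
  proof -
    obtain i j \<Gamma> where ij: "i < m" "j < m" and \<Gamma>: "\<Gamma> \<in> A" and
      "\<Lambda> = folded_box.lift p (I i) (I j) \<Gamma>"
      using \<Lambda> by (auto simp: L_def D_def)
    then show ?thesis
      using folded_box.limit_cycle_lift[OF box[OF ij] A(2)[OF \<Gamma>] square[OF \<Gamma>]] by simp
  qed
  moreover have "finite (L ` D)" using A(1) by (simp add: D_def)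
  ultimately show ?thesis using enat_card_le_hilbert_number[OF Y(1), of "L ` D"] by simp
qed

theorem theorem1:
  fixes n m :: nat
  assumes "n \<ge> 1" and "m \<ge> 2"
  shows "hilbert_number (n * m + m - 1) \<ge> enat (m ^ 2) * hilbert_number n"
proof (cases "hilbert_number (n * m + m - 1)")
  case (enat N)
  \<comment> \<open>With the larger Hilbert number equal to a finite \<open>N\<close>, this bounds
    finite families of limit cycles uniformly in \<open>X\<close>; it then rules out an infinite set
    of limit cycles and an infinite supremum.\<close>
  have bound: "card A \<le> N div m ^ 2"
    if "vf_degree X \<le> n" "finite A" "\<And>\<Gamma>. \<Gamma> \<in> A \<Longrightarrow> limit_cycle X \<Gamma>" for X A
  proof -
    have "1 \<le> m" using assms(2) by simp
    from card_limit_cycles_folding[OF that(1) this that(2,3)]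
    have "m ^ 2 * card A \<le> N" unfolding enat by simp
    then show ?thesis
      using div_le_mono[of "m ^ 2 * card A" N "m ^ 2"] assms(2) by simp
  qed
  have "num_limit_cycles X \<le> enat (N div m ^ 2)" if X: "vf_degree X \<le> n" for X
  proof -
    have fin: "finite {\<Gamma>. limit_cycle X \<Gamma>}"
    proof (rule ccontr)
      assume "infinite {\<Gamma>. limit_cycle X \<Gamma>}"
      \<comment> \<open>An infinite set has a finite subset with one element more than the bound
        allows.\<close>
      then obtain A where "A \<subseteq> {\<Gamma>. limit_cycle X \<Gamma>}" "finite A" "card A = Suc (N div m ^ 2)"
        using infinite_arbitrarily_large by metis
      then show False using bound[OF X, of A] by auto
    qed
    have "card {\<Gamma>. limit_cycle X \<Gamma>} \<le> N div m ^ 2"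
      by (rule bound[OF X fin]) simp
    then show ?thesis by (simp add: num_limit_cycles_def fin)
  qed
  then have "hilbert_number n \<le> enat (N div m ^ 2)"
    unfolding hilbert_number_def by (intro SUP_least) simp
  then have "enat (m ^ 2) * hilbert_number n \<le> enat (m ^ 2) * enat (N div m ^ 2)"
    by (rule mult_left_mono) simp
  also have "\<dots> \<le> enat N" by simp
  finally show ?thesis using enat by simp
qed simp

end
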